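(* Let $w$ be an infinite linearly recurrent aperiodic word over a finite alphabet. Then $w$ is infinite closed-rich.
   Context: Infinite words are one-sided sequences $w=w_0w_1w_2\cdots$ over a finite alphabet. A factor of a word is a contiguous finite subword. A border of a finite word $v$ is a proper prefix of $v$ which is also a suffix of $v$. A finite word $v$ is closed if $|v|\le 1$, or if $|v|\ge 2$ and the longest border of $v$ is non-empty and occurs in $v$ exactly twice (as a prefix and as a suffix). An infinite word $w$ is (infinite) closed-rich if there exists a constant $C>0$ such that for each $n\in\mathbb{N}$ each factor of $w$ of length $n$ contains at least $Cn^2$ distinct closed factors. An infinite word $w$ is linearly recurrent if every factor of $w$ occurs infinitely often in $w$ and there exists a constant $K$ such that for each non-empty factor $u$ of $w$ the length of each return word to $u$ (i.e., the difference between the starting positions of two consecutive occurrences of $u$ in $w$) is at most $K|u|$. Aperiodic means not eventually periodic. *)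

theory Defs
  imports Complex_Main "HOL-Library.Omega_Words_Fun" "HOL-Library.Sublist"
begin

(* Omega_Words_Fun supplies infinite words (nat => 'a) and w [i -> j], the finite word
   w_i ... w_(j-1). Both imports declare "prefix" and "suffix"; the ones for finite words
   are qualified below. *)

definition border :: "'a list \<Rightarrow> 'a list \<Rightarrow> bool" where
  "border u v \<longleftrightarrow> strict_prefix u v \<and> Sublist.suffix u v"

(* Well defined for v \<noteq> []: the empty word is then a border, and borders of equal length
   coincide. *)
definition longest_border :: "'a list \<Rightarrow> 'a list" where
  "longest_border v = (ARG_MAX length u. border u v)"

definition occurrences :: "'a list \<Rightarrow> 'a list \<Rightarrow> nat set" where
  "occurrences u v = {i. i + length u \<le> length v \<and> take (length u) (drop i v) = u}"

definition closed_word :: "'a list \<Rightarrow> bool" where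
  "closed_word v \<longleftrightarrow>
     length v \<le> 1 \<or>
     (length v \<ge> 2 \<and> longest_border v \<noteq> [] \<and> card (occurrences (longest_border v) v) = 2)"

definition factor :: "'a list \<Rightarrow> 'a word \<Rightarrow> bool" where
  "factor u w \<longleftrightarrow> (\<exists>i n. u = w [i \<rightarrow> i + n])"

definition closed_rich :: "'a word \<Rightarrow> bool" where
  "closed_rich w \<longleftrightarrow>
     (\<exists>C::real. C > 0 \<and>
        (\<forall>n v. factor v w \<and> length v = n \<longrightarrow>
           real (card {u. sublist u v \<and> closed_word u}) \<ge> C * (real n)\<^sup>2))"

definition word_occurrences :: "'a list \<Rightarrow> 'a word \<Rightarrow> nat set" where
  "word_occurrences u w = {i. w [i \<rightarrow> i + length u] = u}"

definition consecutive_occurrences :: "'a list \<Rightarrow> 'a word \<Rightarrow> nat \<Rightarrow> nat \<Rightarrow> bool" where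
  "consecutive_occurrences u w i j \<longleftrightarrow>
     i \<in> word_occurrences u w \<and> j \<in> word_occurrences u w \<and> i < j \<and>
     (\<forall>k. i < k \<and> k < j \<longrightarrow> k \<notin> word_occurrences u w)"

definition linearly_recurrent :: "'a word \<Rightarrow> bool" where
  "linearly_recurrent w \<longleftrightarrow>
     (\<forall>u. factor u w \<longrightarrow> infinite (word_occurrences u w)) \<and>
     (\<exists>K::real. \<forall>u. factor u w \<and> u \<noteq> [] \<longrightarrow>
        (\<forall>i j. consecutive_occurrences u w i j \<longrightarrow> real (j - i) \<le> K * real (length u)))"

definition eventually_periodic :: "'a word \<Rightarrow> bool" where
  "eventually_periodic w \<longleftrightarrow> (\<exists>N p. p > 0 \<and> (\<forall>n\<ge>N. w (n + p) = w n))"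

abbreviation aperiodic :: "'a word \<Rightarrow> bool" where
  "aperiodic w \<equiv> \<not> eventually_periodic w"

end

theory Submission
  imports Defs
begin

text \<open>
  A factor \<open>u\<close> together with its next occurrence spans a closed word whose longest border is \<open>u\<close>, and
  by linear recurrence this word has length at most \<open>(K + 1) |u|\<close>. So it suffices to find many distinct
  factors in the first part of a given factor. If two occurrences of a factor of length \<open>m\<close> were at
  distance \<open>p\<close> much smaller than \<open>m\<close>, then \<open>w\<close> would contain a long factor of period \<open>p\<close>, which
  contains all factors of length \<open>p + 1\<close>, and \<open>w\<close> would be periodic. Hence the factors
  of length \<open>m\<close> at \<open>m / (2 K + 1)\<close> consecutive positions are distinct, and summing over \<open>m\<close> gives
  quadratically many closed words.
\<close>

lemma subsequence_eq_iff:
  "w [a \<rightarrow> a + m] = w [b \<rightarrow> b + m] \<longleftrightarrow> (\<forall>t<m. w (a + t) = w (b + t))"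
  by (auto simp: list_eq_iff_nth_eq subsequence_def)

lemma take_drop_subsequence:
  "p + m \<le> l \<Longrightarrow> take m (drop p (w [i \<rightarrow> i + l])) = w [i + p \<rightarrow> i + p + m]"
  by (auto simp: list_eq_iff_nth_eq subsequence_def add.assoc)

lemma factor_subsequence: "factor (w [a \<rightarrow> a + m]) w"
  unfolding factor_def by blast

lemma mem_word_occurrences_subsequence:
  "i \<in> word_occurrences (w [a \<rightarrow> a + m]) w \<longleftrightarrow> (\<forall>t<m. w (i + t) = w (a + t))"
  by (simp add: word_occurrences_def subsequence_eq_iff)

text \<open>A border longer than \<open>u\<close> begins with \<open>u\<close>, because it is a
  prefix of the whole word. Being also a proper suffix, it would place an occurrence of
  \<open>u\<close> strictly between \<open>i\<close> and \<open>j\<close>.\<close>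

lemma longest_border_return:
  assumes cons: "consecutive_occurrences u w i j" and "u \<noteq> []"
  shows "longest_border (w [i \<rightarrow> j + length u]) = u"
proof -
  define m l where "m = length u" and "l = j - i + m"
  define v where "v = w [i \<rightarrow> i + l]"
  have ij: "i < j" and ui: "w [i \<rightarrow> i + m] = u" and uj: "w [j \<rightarrow> j + m] = u"
    and between: "\<And>k. i < k \<Longrightarrow> k < j \<Longrightarrow> w [k \<rightarrow> k + m] \<noteq> u"
    using cons by (auto simp: consecutive_occurrences_def word_occurrences_def m_def)
  have lenv: "length v = l" by (simp add: v_def)
  have border: "border u v"
  proof -
    have "take m v = u"
      using take_drop_subsequence[of 0 m l w i] ui by (simp add: v_def l_def)
    then have "prefix u v" by (metis take_is_prefix)
    moreover have "take m (drop (j - i) v) = u"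
      using take_drop_subsequence[of "j - i" m l w i] uj ij by (simp add: v_def l_def)
    then have "drop (j - i) v = u" using lenv by (simp add: l_def)
    then have "Sublist.suffix u v" by (metis suffix_drop)
    moreover have "u \<noteq> v" using lenv ij by (auto simp: l_def m_def)
    ultimately show ?thesis by (simp add: border_def strict_prefix_def)
  qed
  have maximal: "length x \<le> m" if x: "border x v" for x
  proof (rule ccontr)
    assume "\<not> length x \<le> m"
    then have lx: "m < length x" by simp
    have xv: "length x < l"
      using x lenv by (auto simp: border_def dest: prefix_length_less)
    have "x = take (length x) v"
      using x by (auto simp: border_def strict_prefix_def prefix_def)
    then have "take m x = take m v"
      using lx by (metis min.absorb3 take_take)
    then have xu: "take m x = u"
      using take_drop_subsequence[of 0 m l w i] ui by (simp add: v_def l_def)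
    have "x = drop (l - length x) v"
      using x lenv by (auto simp: border_def Sublist.suffix_def)
    then have "take m x = take m (drop (l - length x) v)" by simp
    also have "\<dots> = w [i + (l - length x) \<rightarrow> i + (l - length x) + m]"
      using take_drop_subsequence[of "l - length x" m l w i] lx xv
      by (simp add: v_def)
    finally have "w [i + (l - length x) \<rightarrow> i + (l - length x) + m] = u" using xu by simp
    moreover have "i < i + (l - length x)" "i + (l - length x) < j"
      using lx xv ij unfolding l_def by linarith+
    ultimately show False using between by blast
  qed
  \<comment> \<open>\<open>ARG_MAX\<close> yields a border only because some border exists and
    border lengths are bounded, which \<open>border\<close> and \<open>maximal\<close>
    supply.\<close>
  have b: "border (longest_border v) v"
    unfolding longest_border_def
    by (rule arg_max_natI[where k = u and b = "m + 1"]) (use border maximal in \<open>auto simp: less_Suc_eq_le\<close>)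
  have "m \<le> length (longest_border v)"
    unfolding longest_border_def m_def
    by (rule arg_max_nat_le[where x = u and b = "m + 1"]) (use border maximal in \<open>auto simp: less_Suc_eq_le\<close>)
  then have "length (longest_border v) = length u"
    using maximal[OF b] by (simp add: m_def)
  then have "longest_border v = u"
    using b border by (auto simp: border_def strict_prefix_def prefix_def)
  then show ?thesis using ij by (simp add: v_def l_def m_def)
qed

text \<open>Occurrences of \<open>u\<close> inside the word are occurrences of \<open>u\<close> in
  \<open>w\<close> at positions from \<open>i\<close> to \<open>j\<close>, and consecutiveness
  leaves only the two ends. They may overlap.\<close>

lemma closed_word_return:
  assumes cons: "consecutive_occurrences u w i j" and "u \<noteq> []"
  shows "closed_word (w [i \<rightarrow> j + length u])"
proof -
  define m l where "m = length u" and "l = j - i + m"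
  define v where "v = w [i \<rightarrow> i + l]"
  have ij: "i < j" using cons by (simp add: consecutive_occurrences_def)
  have v: "w [i \<rightarrow> j + length u] = v" using ij by (simp add: v_def l_def m_def)
  have "m > 0" using \<open>u \<noteq> []\<close> by (simp add: m_def)
  have "occurrences u v = {p. p \<le> j - i \<and> w [i + p \<rightarrow> i + p + m] = u}"
    using take_drop_subsequence[of _ m l w i]
    by (auto simp: occurrences_def v_def l_def simp flip: m_def)
  also have "\<dots> = {0, j - i}"
  proof (intro equalityI subsetI)
    fix p assume p: "p \<in> {p. p \<le> j - i \<and> w [i + p \<rightarrow> i + p + m] = u}"
    then have "\<not> (i < i + p \<and> i + p < j)"
      using cons by (auto simp: consecutive_occurrences_def word_occurrences_def m_def)
    with p ij show "p \<in> {0, j - i}" by auto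
  qed (use cons in \<open>auto simp: consecutive_occurrences_def word_occurrences_def m_def\<close>)
  finally have "card (occurrences u v) = 2" using ij by simp
  moreover have "length v \<ge> 2" using ij \<open>m > 0\<close> by (simp add: v_def l_def)
  ultimately show ?thesis
    using longest_border_return[OF assms] \<open>u \<noteq> []\<close> by (simp add: v closed_word_def)
qed

text \<open>The bound on return words says nothing about existence, so the next occurrence comes
  from infinite recurrence, as the least one after \<open>a\<close>. Rounding the constant up to a
  natural number keeps later estimates in \<open>nat\<close>.\<close>

lemma linearly_recurrent_return:
  assumes "linearly_recurrent w"
  obtains K :: nat where
    "\<And>a m. m > 0 \<Longrightarrow> \<exists>j \<le> a + K * m. consecutive_occurrences (w [a \<rightarrow> a + m]) w a j"
proof -
  obtain K :: real where K: "\<And>u i j. factor u w \<Longrightarrow> u \<noteq> [] \<Longrightarrow> consecutive_occurrences u w i j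
      \<Longrightarrow> real (j - i) \<le> K * real (length u)"
    and inf: "\<And>u. factor u w \<Longrightarrow> infinite (word_occurrences u w)"
    using assms unfolding linearly_recurrent_def by blast
  show ?thesis
  proof (rule that[of "nat \<lceil>K\<rceil>"])
    fix a m :: nat assume m: "m > 0"
    define u where "u = w [a \<rightarrow> a + m]"
    have u: "factor u w" "length u = m" "u \<noteq> []"
      using m by (auto simp: u_def factor_subsequence simp flip: length_greater_0_conv)
    let ?P = "\<lambda>j. a < j \<and> j \<in> word_occurrences u w"
    define j where "j = (LEAST j. ?P j)"
    have "\<exists>j. ?P j" using inf[OF u(1)] by (auto simp: infinite_nat_iff_unbounded)
    then have "?P j" unfolding j_def by (rule LeastI_ex)
    moreover have "\<not> ?P k" if "k < j" for k using that unfolding j_def by (rule not_less_Least)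
    moreover have "a \<in> word_occurrences u w" using u by (simp add: word_occurrences_def u_def)
    ultimately have cons: "consecutive_occurrences u w a j"
      by (auto simp: consecutive_occurrences_def)
    have "real (j - a) \<le> K * real m" using K[OF u(1,3) cons] u by simp
    also have "\<dots> \<le> real (nat \<lceil>K\<rceil>) * real m"
      by (intro mult_right_mono) (simp_all add: of_nat_ceiling)
    finally have "j - a \<le> nat \<lceil>K\<rceil> * m"
      by (metis of_nat_le_iff of_nat_mult)
    then show "\<exists>j \<le> a + nat \<lceil>K\<rceil> * m. consecutive_occurrences (w [a \<rightarrow> a + m]) w a j"
      using cons by (auto simp: u_def intro!: exI[of _ j])
  qed
qed

text \<open>The repetition gives the window of length \<open>p + m\<close> at \<open>a\<close> the
  period \<open>p\<close>. The factor of length \<open>p + 1\<close> at any \<open>n\<close> recurs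
  inside a copy of this window, where its first and last letters agree; hence
  \<open>w n = w (n + p)\<close>.\<close>

lemma close_repetition_eventually_periodic:
  assumes ret: "\<And>a m. m > 0 \<Longrightarrow>
      \<exists>j \<le> a + K * m. consecutive_occurrences (w [a \<rightarrow> a + m]) w a j"
    and inf: "\<And>u. factor u w \<Longrightarrow> infinite (word_occurrences u w)"
    and rep: "w [a \<rightarrow> a + m] = w [a + p \<rightarrow> a + p + m]"
    and p: "p > 0" "(2 * K + 1) * p \<le> m"
  shows "eventually_periodic w"
proof -
  have "w (n + p) = w n" for n
  proof -
    \<comment> \<open>The copy of the window is taken beyond \<open>n\<close>, so that
      \<open>x\<close> has an occurrence before it: only gaps between occurrences are bounded, not
      the position of the first one.\<close>
    have "infinite (word_occurrences (w [a \<rightarrow> a + (p + m)]) w)"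
      by (intro inf factor_subsequence)
    then obtain b where b: "n < b" "b \<in> word_occurrences (w [a \<rightarrow> a + (p + m)]) w"
      by (auto simp: infinite_nat_iff_unbounded)
    define q where "q = p + 1"
    define x where "x = w [n \<rightarrow> n + q]"
    define S where "S = {i. i \<le> b \<and> i \<in> word_occurrences x w}"
    \<comment> \<open>The return \<open>j\<close> of the last occurrence up to \<open>b\<close> lies
      beyond \<open>b\<close>, by at most one gap \<open>K * q\<close>.\<close>
    define i where "i = Max S"
    have "n \<in> S" using b by (simp add: S_def x_def mem_word_occurrences_subsequence)
    moreover have "finite S" by (rule finite_subset[of _ "{..b}"]) (auto simp: S_def)
    ultimately have iS: "i \<in> S" and i_max: "\<And>k. k \<in> S \<Longrightarrow> k \<le> i"
      unfolding i_def by (auto intro: Max_in)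
    have "w [i \<rightarrow> i + q] = x"
      using iS by (simp add: S_def x_def word_occurrences_def)
    with ret[of q i] obtain j where j: "j \<le> i + K * q" "consecutive_occurrences x w i j"
      by (auto simp: q_def)
    have jx: "j \<in> word_occurrences x w" "i < j"
      using j by (auto simp: consecutive_occurrences_def)
    have "b < j" using i_max[of j] jx by (force simp: S_def)
    define t where "t = j - b"
    have jt: "j = b + t" using \<open>b < j\<close> by (simp add: t_def)
    have "t \<le> K * q" using j(1) iS by (auto simp: S_def t_def)
    \<comment> \<open>Here \<open>p + 1 \<le> 2 * p\<close>, which is where the factor
      \<open>2 * K + 1\<close> comes from.\<close>
    also have "\<dots> \<le> K * (2 * p)" using p by (intro mult_left_mono) (auto simp: q_def)
    also have "\<dots> < (2 * K + 1) * p" using p by (simp add: algebra_simps)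
    finally have tm: "t < m" using p by simp
    have per: "w (a + t) = w (a + p + t)" using rep tm by (simp add: subsequence_eq_iff)
    have bw: "\<And>s. s < p + m \<Longrightarrow> w (b + s) = w (a + s)"
      using b(2) by (simp add: mem_word_occurrences_subsequence)
    have jw: "\<And>s. s < q \<Longrightarrow> w (j + s) = w (n + s)"
      using jx(1) by (simp only: x_def mem_word_occurrences_subsequence)
    have "w (n + p) = w (b + (p + t))" using jw[of p] by (simp add: jt q_def ac_simps)
    also have "\<dots> = w (a + (p + t))" using tm by (intro bw) simp
    also have "\<dots> = w (a + t)" using per by (simp add: add.assoc)
    also have "\<dots> = w (b + t)" using bw[of t] tm by simp
    also have "\<dots> = w n" using jw[of 0] by (simp add: jt q_def)
    finally show ?thesis .
  qed
  then show ?thesis using p unfolding eventually_periodic_def by blast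
qed

theorem proposition6:
  fixes A :: "'a set" and w :: "'a word"
  assumes "finite A" and "range w \<subseteq> A"
    and "linearly_recurrent w"
    and "aperiodic w"
  shows "closed_rich w"
proof -
  obtain K :: nat where ret:
    "\<And>a m. m > 0 \<Longrightarrow> \<exists>j \<le> a + K * m. consecutive_occurrences (w [a \<rightarrow> a + m]) w a j"
    using linearly_recurrent_return[OF assms(3)] by blast
  have inf: "\<And>u. factor u w \<Longrightarrow> infinite (word_occurrences u w)"
    using assms(3) by (simp add: linearly_recurrent_def)
  define r where
    "r a m = (SOME j. j \<le> a + K * m \<and> consecutive_occurrences (w [a \<rightarrow> a + m]) w a j)" for a m
  have r_bound: "r a m \<le> a + K * m"
    and r: "consecutive_occurrences (w [a \<rightarrow> a + m]) w a (r a m)" if "m > 0" for a m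
    using someI_ex[OF ret[OF that, of a]] unfolding r_def by blast+
  \<comment> \<open>\<open>M\<close> makes offsets below \<open>N\<close> too close for a repetition
    of length \<open>m > M * N\<close>. \<open>D\<close> makes everything fit: with
    \<open>k \<le> m\<close> and closed words of length at most \<open>(K + 1) * m\<close>, each
    ends by \<open>(K + 2) * m \<le> D * N \<le> n\<close>.\<close>
  define M where "M = 2 * K + 1"
  define D where "D = (M + 1) * (K + 2)"
  have "real (card {u. sublist u v \<and> closed_word u}) \<ge> 1 / (2 * (real D)\<^sup>2) * (real n)\<^sup>2"
    if v: "factor v w" "length v = n" for n v
  proof -
    obtain i where vi: "v = w [i \<rightarrow> i + n]"
      using v by (auto simp: factor_def)
    define N where "N = n div D"
    \<comment> \<open>\<open>N\<close> lengths \<open>m\<close> and \<open>N\<close> offsets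
      \<open>k\<close> index \<open>N * N\<close> closed words, each spanned by the factor of length
      \<open>m\<close> at offset \<open>k\<close> and its return.\<close>
    define I where "I = {M * N<..M * N + N} \<times> {..<N}"
    define f where "f = (\<lambda>(m, k). w [i + k \<rightarrow> r (i + k) m + m])"
    have lb: "longest_border (f (m, k)) = w [i + k \<rightarrow> i + k + m]"
      and closed: "closed_word (f (m, k))" if "m > 0" for m k
      using longest_border_return[OF r[OF that, of "i + k"]]
        closed_word_return[OF r[OF that, of "i + k"]] that
      by (auto simp: f_def simp flip: length_greater_0_conv)
    have far: "w [i + k \<rightarrow> i + k + m] \<noteq> w [i + k' \<rightarrow> i + k' + m]"
      if "k < k'" "k' < N" "M * N < m" for m k k'
    proof
      assume eq: "w [i + k \<rightarrow> i + k + m] = w [i + k' \<rightarrow> i + k' + m]"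
      have "M * (k' - k) \<le> M * N" using that by (intro mult_left_mono) auto
      then have "(2 * K + 1) * (k' - k) \<le> m" using that by (simp add: M_def)
      with eq that have "eventually_periodic w"
        by (intro close_repetition_eventually_periodic[OF ret inf, where a = "i + k" and p = "k' - k"])
          simp_all
      with assms(4) show False by blast
    qed
    \<comment> \<open>A closed word determines its longest border, whose length is \<open>m\<close>;
      for this \<open>m\<close>, \<open>far\<close> then determines \<open>k\<close>.\<close>
    have inj: "inj_on f I"
    proof (rule inj_onI)
      fix x y assume x: "x \<in> I" and y: "y \<in> I" and eq: "f x = f y"
      obtain m k m' k' where xy: "x = (m, k)" "y = (m', k')" by fastforce
      have eq': "w [i + k \<rightarrow> i + k + m] = w [i + k' \<rightarrow> i + k' + m']"
        using lb[of m k] lb[of m' k'] eq x y by (simp add: xy I_def)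
      from arg_cong[OF this, of length] have m: "m = m'" by simp
      have "k = k'"
        using far[of k k' m] far[of k' k m] eq' x y by (cases k k' rule: linorder_cases) (auto simp: xy I_def m)
      with m show "x = y" by (simp add: xy)
    qed
    let ?C = "{u. sublist u v \<and> closed_word u}"
    \<comment> \<open>Setting the empty word aside gains one more closed factor, which covers short
      \<open>v\<close>, where \<open>N = 0\<close>.\<close>
    have sub: "f ` I \<subseteq> ?C - {[]}"
    proof safe
      fix m k assume mk: "(m, k) \<in> I"
      then have m: "m > 0" by (auto simp: I_def)
      show "closed_word (f (m, k))" by (rule closed[OF m])
      let ?l = "r (i + k) m + m - (i + k)"
      have ir: "i + k < r (i + k) m" using r[OF m] by (simp add: consecutive_occurrences_def)
      have "m \<le> (M + 1) * N" using mk by (auto simp: I_def)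
      then have "m * (K + 2) \<le> (M + 1) * N * (K + 2)" by (intro mult_right_mono) auto
      also have "\<dots> = D * N" by (simp only: D_def ac_simps)
      also have "\<dots> \<le> n" unfolding N_def by simp
      finally have mn: "m * (K + 2) \<le> n" .
      have "k < N" "N \<le> M * N" "M * N < m" using mk by (auto simp: I_def M_def)
      then have "k \<le> m" by linarith
      then have "k + ?l \<le> n" using ir r_bound[OF m, of "i + k"] mn by (simp add: algebra_simps)
      from take_drop_subsequence[OF this, of w i] have "f (m, k) = take ?l (drop k v)"
        using ir by (simp add: f_def vi)
      then show "sublist (f (m, k)) v"
        by (metis sublist_drop sublist_take sublist_order.order_trans)
      assume "f (m, k) = []"
      then show False using ir m by (simp add: f_def flip: length_0_conv)
    qed
    have fin: "finite ?C"
      by (rule finite_subset[of _ "set (sublists v)"]) auto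
    have "N * N = card (f ` I)" using inj by (simp add: card_image I_def)
    also have "\<dots> \<le> card (?C - {[]})" using fin sub by (intro card_mono) auto
    also have "\<dots> = card ?C - 1"
      by (rule card_Diff_singleton) (simp add: closed_word_def)
    finally have "N * N \<le> card ?C - 1" .
    moreover have "card ?C > 0"
      using fin by (subst card_gt_0_iff) (auto simp: closed_word_def intro!: exI[of _ "[]"])
    ultimately have "N * N + 1 \<le> card ?C" by simp
    then have C: "real N * real N + 1 \<le> real (card ?C)"
      by (metis of_nat_1 of_nat_add of_nat_le_iff of_nat_mult)
    have D: "D > 0" by (simp add: D_def)
    have "n < D * (N + 1)"
      unfolding N_def using D dividend_less_times_div[of D n] by simp
    then have "real n \<le> real D * (real N + 1)"
      by (metis less_imp_le of_nat_1 of_nat_add of_nat_le_iff of_nat_mult)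
    then have "(real n)\<^sup>2 \<le> (real D * (real N + 1))\<^sup>2" by (rule power_mono) simp
    also have "\<dots> = (real D)\<^sup>2 * (real N + 1)\<^sup>2" by (rule power_mult_distrib)
    \<comment> \<open>From \<open>(N - 1)^2 \<ge> 0\<close>; this is the 2 in the constant
      \<open>1 / (2 * D^2)\<close>.\<close>
    also have "\<dots> \<le> (real D)\<^sup>2 * (2 * (real N * real N + 1))"
      using zero_le_square[of "real N - 1"]
      by (intro mult_left_mono) (simp_all add: power2_eq_square algebra_simps)
    also have "\<dots> \<le> (real D)\<^sup>2 * (2 * real (card ?C))" using C by (intro mult_left_mono) auto
    finally show ?thesis using D by (simp add: field_simps)
  qed
  moreover have "1 / (2 * (real D)\<^sup>2) > 0"
    by (simp add: D_def flip: of_nat_add of_nat_mult)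
  ultimately show ?thesis unfolding closed_rich_def by blast
qed

end
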